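(* The operator $\mathbb{H}_{\Phi,\mu}$ with the domain $D$ is closable in $L^2(\mathbb{R})$ if $\Phi\in L^1(\mu)$.
   Context: $\mu$ is a regular positive Borel measure on $(0,\infty)$ and $\Phi:(0,\infty)\to\mathbb{C}$ is $\mu$-measurable. The Hausdorff operator is $(\mathbb{H}_{\Phi,\mu}F)(t)=\int_0^\infty \Phi(u)F(t/u)\,d\mu(u)$, here considered as an operator in $L^2(\mathbb{R})$ with domain $D:=\{f: f=\widehat\psi,\ \psi\in C^2(\mathbb{R}),\ \mathrm{supp}(\psi)\subset[-\pi,\pi]\}$, where the hat is the Fourier transform, $\widehat\psi(x)=\frac1{\sqrt{2\pi}}\int\psi(s)e^{-isx}ds$ (normalization immaterial for $D$). *)

theory Defs
  imports "HOL-Analysis.Analysis"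
begin

text \<open>
  Elements of \<open>L\<^sup>2(\<real>)\<close> are handled through representatives; functions that agree almost
  everywhere are identified. Borel measurable representatives suffice, since every Lebesgue
  measurable function agrees almost everywhere with a Borel measurable one.
\<close>

definition L2 :: "(real \<Rightarrow> complex) set" where
  "L2 = {f. f \<in> borel_measurable lborel \<and> integrable lborel (\<lambda>t. (cmod (f t))\<^sup>2)}"

definition L2_norm :: "(real \<Rightarrow> complex) \<Rightarrow> real" where
  "L2_norm f = sqrt (LINT t|lborel. (cmod (f t))\<^sup>2)"

definition L2_tendsto :: "(nat \<Rightarrow> real \<Rightarrow> complex) \<Rightarrow> (real \<Rightarrow> complex) \<Rightarrow> bool" where
  "L2_tendsto X f \<longleftrightarrow> (\<lambda>n. L2_norm (\<lambda>t. X n t - f t)) \<longlonglongrightarrow> 0"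

text \<open>
  A (partially defined, complex linear) operator in \<open>L\<^sup>2(\<real>)\<close> is given by its graph: a linear
  subspace of \<open>L\<^sup>2(\<real>) \<times> L\<^sup>2(\<real>)\<close> that is single-valued modulo almost everywhere equality.
\<close>

definition L2_operator :: "((real \<Rightarrow> complex) \<times> (real \<Rightarrow> complex)) set \<Rightarrow> bool" where
  "L2_operator G \<longleftrightarrow>
     G \<subseteq> L2 \<times> L2 \<and>
     ((\<lambda>t. 0), (\<lambda>t. 0)) \<in> G \<and>
     (\<forall>f g f' g'. (f, g) \<in> G \<longrightarrow> (f', g') \<in> G \<longrightarrow>
        ((\<lambda>t. f t + f' t), (\<lambda>t. g t + g' t)) \<in> G) \<and>
     (\<forall>c f g. (f, g) \<in> G \<longrightarrow> ((\<lambda>t. c * f t), (\<lambda>t. c * g t)) \<in> G) \<and>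
     (\<forall>f g f' g'. (f, g) \<in> G \<longrightarrow> (f', g') \<in> G \<longrightarrow>
        (AE t in lborel. f t = f' t) \<longrightarrow> (AE t in lborel. g t = g' t))"

text \<open>
  The graph is closed in \<open>L\<^sup>2(\<real>) \<times> L\<^sup>2(\<real>)\<close>. Constant sequences show that a closed graph is
  automatically invariant under changing representatives.
\<close>

definition L2_closed_operator :: "((real \<Rightarrow> complex) \<times> (real \<Rightarrow> complex)) set \<Rightarrow> bool" where
  "L2_closed_operator G \<longleftrightarrow>
     L2_operator G \<and>
     (\<forall>X Y f g. (\<forall>n. (X n, Y n) \<in> G) \<longrightarrow> f \<in> L2 \<longrightarrow> g \<in> L2 \<longrightarrow>
        L2_tendsto X f \<longrightarrow> L2_tendsto Y g \<longrightarrow> (f, g) \<in> G)"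

text \<open>
  \<open>T\<close> with domain \<open>D\<close> is closable if it has a closed extension. Only those \<open>f \<in> D\<close> are
  considered for which \<open>T f\<close> belongs to \<open>L\<^sup>2(\<real>)\<close>, as only they contribute to a graph in
  \<open>L\<^sup>2(\<real>) \<times> L\<^sup>2(\<real>)\<close>; when \<open>T\<close> maps \<open>D\<close> into \<open>L\<^sup>2(\<real>)\<close> this is no restriction.
\<close>

definition L2_closable ::
    "((real \<Rightarrow> complex) \<Rightarrow> (real \<Rightarrow> complex)) \<Rightarrow> (real \<Rightarrow> complex) set \<Rightarrow> bool" where
  "L2_closable T D \<longleftrightarrow>
     (\<exists>G. L2_closed_operator G \<and> (\<forall>f\<in>D. T f \<in> L2 \<longrightarrow> (f, T f) \<in> G))"

text \<open>
  Regularity means that every Borel set is outer regular (by open sets) and inner regular (by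
  compact sets). Finiteness on compact sets is not required. A subset of \<open>(0,\<infinity>)\<close> is open
  (compact) in \<open>(0,\<infinity>)\<close> iff it is open (compact) in \<open>\<real>\<close>.
\<close>

definition regular_borel_measure_pos :: "real measure \<Rightarrow> bool" where
  "regular_borel_measure_pos \<mu> \<longleftrightarrow>
     sets \<mu> = sets (restrict_space borel {0<..}) \<and>
     (\<forall>B\<in>sets \<mu>.
        emeasure \<mu> B = (INF U\<in>{U. open U \<and> B \<subseteq> U \<and> U \<subseteq> {0<..}}. emeasure \<mu> U) \<and>
        emeasure \<mu> B = (SUP K\<in>{K. compact K \<and> K \<subseteq> B}. emeasure \<mu> K))"

text \<open>
  The completion of \<open>\<mu>\<close> admits all \<open>\<mu>\<close>-measurable \<open>\<Phi>\<close>, not only the Borel measurable ones.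
\<close>

definition hausdorff_op ::
    "(real \<Rightarrow> complex) \<Rightarrow> real measure \<Rightarrow> (real \<Rightarrow> complex) \<Rightarrow> real \<Rightarrow> complex" where
  "hausdorff_op \<Phi> \<mu> F t = (LINT u|completion \<mu>. \<Phi> u * F (t / u))"

definition fourier :: "(real \<Rightarrow> complex) \<Rightarrow> real \<Rightarrow> complex" where
  "fourier \<psi> x =
     complex_of_real (1 / sqrt (2 * pi)) *
       (LINT s|lborel. \<psi> s * exp (- \<i> * complex_of_real s * complex_of_real x))"

definition C2 :: "(real \<Rightarrow> complex) \<Rightarrow> bool" where
  "C2 \<psi> \<longleftrightarrow>
     (\<exists>\<psi>' \<psi>''. (\<forall>x. (\<psi> has_vector_derivative \<psi>' x) (at x)) \<and>
              (\<forall>x. (\<psi>' has_vector_derivative \<psi>'' x) (at x)) \<and>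
              continuous_on UNIV \<psi>'')"

definition hausdorff_dom :: "(real \<Rightarrow> complex) set" where
  "hausdorff_dom = {fourier \<psi> | \<psi>. C2 \<psi> \<and> closure {s. \<psi> s \<noteq> 0} \<subseteq> {-pi..pi}}"

end

theory Submission
  imports Defs "HOL-Probability.Characteristic_Functions"
begin

text \<open>
  A function \<open>F = fourier \<psi>\<close> with \<open>\<psi>\<close> supported in \<open>[-\<pi>, \<pi>]\<close> is controlled pointwise by its own
  \<open>L\<^sup>2\<close> norm: the Cauchy-Schwarz inequality on an interval of length \<open>2\<pi>\<close> and the Plancherel
  identity give \<open>\<bar>F x\<bar> \<le> \<parallel>\<psi>\<parallel>\<^sub>1 / sqrt (2\<pi>) \<le> \<parallel>\<psi>\<parallel>\<^sub>2 = \<parallel>F\<parallel>\<^sub>2\<close>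
  (\<open>fourier_sup_le_L2_norm\<close>). For integrable \<open>\<Phi>\<close> the Hausdorff operator \<open>T\<close> is bounded with respect
  to the supremum norm, by \<open>\<parallel>\<Phi>\<parallel>\<^sub>1\<close>. Hence \<open>\<bar>T F t\<bar> \<le> \<parallel>\<Phi>\<parallel>\<^sub>1 \<parallel>F\<parallel>\<^sub>2\<close> for all \<open>t\<close> and all \<open>F\<close> in the
  domain: if \<open>F\<^sub>n \<rightarrow> 0\<close> in \<open>L\<^sup>2\<close>, then \<open>T F\<^sub>n \<rightarrow> 0\<close> uniformly, and if moreover \<open>T F\<^sub>n \<rightarrow> g\<close> in \<open>L\<^sup>2\<close>,
  then \<open>g\<close> vanishes almost everywhere. This is closability, and \<open>L2_closable_if_sup_bounded\<close>
  derives it for any linear operator with such a bound.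

  The Plancherel identity is needed for continuous \<open>\<psi>\<close> of compact support, and it comes with the
  square integrability of the functions in the domain. It is obtained by Gaussian regularisation:
  with the weight \<open>exp (- (\<sigma> x)\<^sup>2 / 2)\<close> the integral of \<open>\<bar>F\<bar>\<^sup>2\<close> equals the integral of \<open>\<psi>\<close> against
  the conjugate of an average of \<open>\<psi>\<close> over a normal distribution of standard deviation \<open>\<sigma>\<close>
  (\<open>fourier_gauss_regularised\<close>). As \<open>\<sigma>\<close> decreases to \<open>0\<close>, dominated convergence gives the limit of
  the right-hand side, and monotone convergence then removes the weight on the left.
\<close>

section \<open>The seminorm of \<open>L\<^sup>2\<close>\<close>

lemma L2_norm_nonneg: "0 \<le> L2_norm f"
  by (simp add: L2_norm_def integral_nonneg_AE)

lemma L2_norm_power2: "(L2_norm f)\<^sup>2 = (LINT t|lborel. (cmod (f t))\<^sup>2)"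
  by (simp add: L2_norm_def integral_nonneg_AE)

lemma L2_norm_cong_AE:
  assumes "f \<in> borel_measurable lborel" "g \<in> borel_measurable lborel"
    and "AE t in lborel. f t = g t"
  shows "L2_norm f = L2_norm g"
proof -
  note [measurable] = assms(1,2)
  have "AE t in lborel. (cmod (f t))\<^sup>2 = (cmod (g t))\<^sup>2"
    using assms(3) by eventually_elim simp
  then have "(LINT t|lborel. (cmod (f t))\<^sup>2) = (LINT t|lborel. (cmod (g t))\<^sup>2)"
    by (intro integral_cong_AE) measurable
  then show ?thesis by (simp add: L2_norm_def)
qed

lemma L2_bound:
  assumes "g \<in> L2" "f \<in> borel_measurable lborel" "\<And>t. cmod (f t) \<le> cmod (g t)"
  shows "f \<in> L2" and "L2_norm f \<le> L2_norm g"
proof -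
  have g: "integrable lborel (\<lambda>t. (cmod (g t))\<^sup>2)"
    using assms by (simp add: L2_def)
  have f: "integrable lborel (\<lambda>t. (cmod (f t))\<^sup>2)"
    by (rule Bochner_Integration.integrable_bound[OF g])
       (use assms in \<open>auto intro!: power_mono\<close>)
  show "f \<in> L2" using f assms by (simp add: L2_def)
  show "L2_norm f \<le> L2_norm g"
    unfolding L2_norm_def
    by (intro real_sqrt_le_mono integral_mono f g power_mono assms) auto
qed

lemma L2_zero: "(\<lambda>t. 0) \<in> L2"
  by (simp add: L2_def)

lemma L2_scale: "f \<in> L2 \<Longrightarrow> (\<lambda>t. c * f t) \<in> L2"
  by (simp add: L2_def norm_mult power_mult_distrib borel_measurable_times)

lemma L2_norm_scale: "L2_norm (\<lambda>t. c * f t) = cmod c * L2_norm f"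
  by (simp add: L2_norm_def norm_mult power_mult_distrib real_sqrt_mult)

text \<open>
  Convexity of the square with the weights \<open>a / (a + b)\<close> and \<open>b / (a + b)\<close>. Integrated with \<open>a\<close> and
  \<open>b\<close> slightly above the two norms, it is Minkowski's inequality; this avoids dividing by a norm
  that may be zero.
\<close>

lemma square_add_weighted:
  fixes x y a b :: real
  assumes "0 < a" "0 < b"
  shows "(x + y)\<^sup>2 \<le> (a + b) / a * x\<^sup>2 + (a + b) / b * y\<^sup>2"
proof -
  have "(a + b) / a * x\<^sup>2 + (a + b) / b * y\<^sup>2 - (x + y)\<^sup>2 = (b * x - a * y)\<^sup>2 / (a * b)"
    using assms by (simp add: field_simps power2_eq_square)
  moreover have "0 \<le> \<dots>" using assms by simp
  ultimately show ?thesis by linarith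
qed

lemma cmod_add_square_weighted:
  fixes x y :: complex and a b :: real
  assumes "0 < a" "0 < b"
  shows "(cmod (x + y))\<^sup>2 \<le> (a + b) / a * (cmod x)\<^sup>2 + (a + b) / b * (cmod y)\<^sup>2"
proof -
  have "(cmod (x + y))\<^sup>2 \<le> (cmod x + cmod y)\<^sup>2"
    by (intro power_mono norm_triangle_ineq) simp
  also note square_add_weighted[OF assms]
  finally show ?thesis .
qed

lemma L2_add:
  assumes "f \<in> L2" "g \<in> L2"
  shows "(\<lambda>t. f t + g t) \<in> L2"
proof -
  have [measurable]: "f \<in> borel_measurable lborel" "g \<in> borel_measurable lborel"
    using assms by (simp_all add: L2_def)
  \<comment> \<open>The weighted inequality with \<open>a = b = 1\<close>; the coefficients keep its literal form.\<close>
  have "integrable lborel (\<lambda>t. (1 + 1) / 1 * (cmod (f t))\<^sup>2 + (1 + 1) / 1 * (cmod (g t))\<^sup>2)"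
    using assms by (intro Bochner_Integration.integrable_add integrable_mult_right) (auto simp: L2_def)
  then have "integrable lborel (\<lambda>t. (cmod (f t + g t))\<^sup>2)"
  proof (rule Bochner_Integration.integrable_bound)
    show "AE t in lborel. norm ((cmod (f t + g t))\<^sup>2)
        \<le> norm ((1 + 1) / 1 * (cmod (f t))\<^sup>2 + (1 + 1) / 1 * (cmod (g t))\<^sup>2)"
      using cmod_add_square_weighted[of 1 1 "f _" "g _"]
      by (intro AE_I2) (simp only: real_norm_def, subst abs_of_nonneg, simp, subst abs_of_nonneg, auto)
  qed measurable
  then show ?thesis by (simp add: L2_def)
qed

lemma L2_diff: "f \<in> L2 \<Longrightarrow> g \<in> L2 \<Longrightarrow> (\<lambda>t. f t - g t) \<in> L2"
  using L2_add[of f "\<lambda>t. (-1) * g t"] L2_scale[of g "-1"] by simp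

lemma L2_norm_add_less:
  assumes "f \<in> L2" "g \<in> L2" and less: "L2_norm f < a" "L2_norm g < b"
  shows "L2_norm (\<lambda>t. f t + g t) < a + b"
proof -
  have pos: "0 < a" "0 < b"
    using less L2_norm_nonneg[of f] L2_norm_nonneg[of g] by linarith+
  have int: "integrable lborel (\<lambda>t. (cmod (f t))\<^sup>2)" "integrable lborel (\<lambda>t. (cmod (g t))\<^sup>2)"
    "integrable lborel (\<lambda>t. (cmod (f t + g t))\<^sup>2)"
    using assms L2_add[of f g] by (auto simp: L2_def)
  have "(L2_norm (\<lambda>t. f t + g t))\<^sup>2
      \<le> (LINT t|lborel. (a + b) / a * (cmod (f t))\<^sup>2 + (a + b) / b * (cmod (g t))\<^sup>2)"
    unfolding L2_norm_power2
    by (intro integral_mono int Bochner_Integration.integrable_add integrable_mult_right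
        cmod_add_square_weighted pos)
  also have "\<dots> = (a + b) / a * (L2_norm f)\<^sup>2 + (a + b) / b * (L2_norm g)\<^sup>2"
    by (subst Bochner_Integration.integral_add) (simp_all add: L2_norm_power2 int)
  also have "\<dots> < (a + b) / a * a\<^sup>2 + (a + b) / b * b\<^sup>2"
    using pos less by (intro add_strict_mono mult_strict_left_mono power_strict_mono)
      (auto simp: L2_norm_nonneg)
  also have "\<dots> = (a + b)\<^sup>2"
  proof -
    have "(a + b) / a * a\<^sup>2 = (a + b) * a" "(a + b) / b * b\<^sup>2 = (a + b) * b"
      using pos by (simp_all add: power2_eq_square)
    then show ?thesis by (simp add: power2_eq_square distrib_left)
  qed
  finally show ?thesis
    by (rule power_less_imp_less_base) (use pos in simp)
qed

lemma L2_norm_diff_less: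
  assumes "f \<in> L2" "g \<in> L2" "L2_norm f < a" "L2_norm g < b"
  shows "L2_norm (\<lambda>t. f t - g t) < a + b"
proof -
  have "L2_norm (\<lambda>t. f t + (-1) * g t) < a + b"
    using assms by (intro L2_norm_add_less L2_scale) (simp_all only: L2_norm_scale, simp_all)
  then show ?thesis by simp
qed

lemma L2_norm_eq_0_AE:
  assumes "f \<in> L2" "L2_norm f = 0"
  shows "AE t in lborel. f t = 0"
proof -
  have "(LINT t|lborel. (cmod (f t))\<^sup>2) = 0"
    using assms(2) L2_norm_power2[of f] by simp
  then have "AE t in lborel. (cmod (f t))\<^sup>2 = 0"
    using assms(1) by (subst (asm) integral_nonneg_eq_0_iff_AE) (auto simp: L2_def)
  then show ?thesis by simp
qed

lemma L2_truncated:
  fixes R :: real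
  assumes "f \<in> L2"
  shows "(\<lambda>t. indicator {-R..R} t * f t) \<in> L2"
    and "L2_norm (\<lambda>t. indicator {-R..R} t * f t) \<le> L2_norm f"
proof -
  have [measurable]: "f \<in> borel_measurable lborel" using assms by (simp add: L2_def)
  have m: "(\<lambda>t. indicator {-R..R} t * f t) \<in> borel_measurable lborel" by measurable
  have le: "cmod (indicator {-R..R} t * f t) \<le> cmod (f t)" for t
    by (simp split: split_indicator)
  show "(\<lambda>t. indicator {-R..R} t * f t) \<in> L2"
    and "L2_norm (\<lambda>t. indicator {-R..R} t * f t) \<le> L2_norm f"
    using L2_bound[OF assms m le] .
qed

text \<open>
  On a bounded window uniform smallness becomes \<open>L\<^sup>2\<close> smallness. Through this the uniform limit
  and the \<open>L\<^sup>2\<close> limit of the same sequence are compared.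
\<close>

lemma L2_truncated_bounded:
  fixes R B :: real
  assumes [measurable]: "f \<in> borel_measurable lborel" and B: "\<And>t. cmod (f t) \<le> B" and "0 \<le> R"
  shows "(\<lambda>t. indicator {-R..R} t * f t) \<in> L2"
    and "L2_norm (\<lambda>t. indicator {-R..R} t * f t) \<le> B * sqrt (2 * R)"
proof -
  have B0: "0 \<le> B" using B[of 0] norm_ge_zero[of "f 0"] by linarith
  have int: "integrable lborel (\<lambda>t. (cmod (complex_of_real B * indicator {-R..R} t))\<^sup>2)"
    by (rule Bochner_Integration.integrable_bound[of lborel "\<lambda>t. B\<^sup>2 * indicator {-R..R} t",
          OF integrable_mult_right[OF integrable_real_indicator]])
       (use \<open>0 \<le> R\<close> in \<open>auto split: split_indicator simp: norm_mult power_mult_distrib\<close>)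
  have L2: "(\<lambda>t. complex_of_real B * indicator {-R..R} t) \<in> L2"
    using int by (simp add: L2_def)
  have le: "cmod (indicator {-R..R} t * f t) \<le> cmod (complex_of_real B * indicator {-R..R} t)" for t
    using B[of t] B0 by (auto split: split_indicator)
  show "(\<lambda>t. indicator {-R..R} t * f t) \<in> L2"
    by (rule L2_bound(1)[OF L2 _ le]) measurable
  have "L2_norm (\<lambda>t. indicator {-R..R} t * f t) \<le> L2_norm (\<lambda>t. complex_of_real B * indicator {-R..R} t)"
    by (rule L2_bound(2)[OF L2 _ le]) measurable
  also have "\<dots> = B * L2_norm (indicator {-R..R})"
    using B0 by (simp add: L2_norm_scale)
  also have "L2_norm (indicator {-R..R}) = sqrt (LINT t|lborel. indicator {-R..R} t)"
    unfolding L2_norm_def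
    by (intro arg_cong[where f=sqrt] Bochner_Integration.integral_cong) (auto split: split_indicator)
  also have "\<dots> = sqrt (2 * R)" using \<open>0 \<le> R\<close> by simp
  finally show "L2_norm (\<lambda>t. indicator {-R..R} t * f t) \<le> B * sqrt (2 * R)" .
qed

text \<open>
  An error estimate ends with a multiple of \<open>e\<close> rather than \<open>e\<close> itself; this absorbs the factor.
\<close>

lemma real_eq_0_if_le_mult:
  fixes x K :: real
  assumes "0 \<le> x" "\<And>e. e > 0 \<Longrightarrow> x \<le> K * e"
  shows "x = 0"
proof (rule antisym[OF field_le_epsilon assms(1)])
  fix e :: real assume e: "e > 0"
  have "x \<le> (\<bar>K\<bar> + 1) * (e / (\<bar>K\<bar> + 1))"
  proof (rule order_trans[OF assms(2)])
    show "K * (e / (\<bar>K\<bar> + 1)) \<le> (\<bar>K\<bar> + 1) * (e / (\<bar>K\<bar> + 1))"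
      using e by (intro mult_right_mono) auto
  qed (use e in \<open>simp add: add_nonneg_pos\<close>)
  also have "\<dots> = e" by (simp add: add_nonneg_pos add_eq_0_iff)
  finally show "x \<le> 0 + e" by simp
qed

section \<open>Closability from a supremum bound\<close>

text \<open>
  The closed extension \<open>G\<close> is the closure of the graph, with \<open>T\<close> restricted to those \<open>F\<close> for
  which \<open>T F\<close> is square integrable. Describing the closure by approximation up to every \<open>e > 0\<close>
  rather than by sequences makes closedness a mere triangle inequality. The essential point is
  that \<open>G\<close> is single-valued. If \<open>(f, g)\<close> and \<open>(f, g')\<close> are approximated by \<open>(F, T F)\<close> and
  \<open>(F', T F')\<close>, then \<open>H = F - F'\<close> is small in \<open>L\<^sup>2\<close>, so \<open>T H\<close> is uniformly small, hence small in \<open>L\<^sup>2\<close>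
  over every bounded window; but \<open>T H\<close> is also \<open>L\<^sup>2\<close>-close to \<open>g - g'\<close>.
\<close>

lemma L2_closable_if_sup_bounded:
  assumes D: "D \<subseteq> L2" "(\<lambda>t. 0) \<in> D"
    "\<And>F H. F \<in> D \<Longrightarrow> H \<in> D \<Longrightarrow> (\<lambda>t. F t + H t) \<in> D"
    "\<And>c F. F \<in> D \<Longrightarrow> (\<lambda>t. c * F t) \<in> D"
    and T: "\<And>F H. F \<in> D \<Longrightarrow> H \<in> D \<Longrightarrow> T (\<lambda>t. F t + H t) = (\<lambda>t. T F t + T H t)"
    "\<And>c F. F \<in> D \<Longrightarrow> T (\<lambda>t. c * F t) = (\<lambda>t. c * T F t)"
    and bound: "\<And>F t. F \<in> D \<Longrightarrow> cmod (T F t) \<le> C * L2_norm F"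
  shows "L2_closable T D"
proof -
  define near where "near e f g F \<longleftrightarrow> F \<in> D \<and> T F \<in> L2 \<and>
      L2_norm (\<lambda>t. F t - f t) < e \<and> L2_norm (\<lambda>t. T F t - g t) < e" for e f g F
  define G where "G = {(f, g). f \<in> L2 \<and> g \<in> L2 \<and> (\<forall>e>0. \<exists>F. near e f g F)}"
  have G_sub: "G \<subseteq> L2 \<times> L2" by (auto simp: G_def)
  have DL2: "F \<in> L2" if "F \<in> D" for F using that D(1) by auto
  have graph: "(F, T F) \<in> G" if "F \<in> D" "T F \<in> L2" for F
  proof -
    have "near e F (T F) F" if "e > 0" for e :: real
      using that \<open>F \<in> D\<close> \<open>T F \<in> L2\<close> by (simp add: near_def L2_norm_def)
    then show ?thesis using that DL2 by (auto simp: G_def)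
  qed
  have T0: "T (\<lambda>t. 0) = (\<lambda>t. 0)"
    using T(2)[OF D(2), of 0] by simp
  have zero: "((\<lambda>t. 0), (\<lambda>t. 0)) \<in> G"
    using graph[OF D(2)] by (simp add: T0 L2_zero)
  have add: "((\<lambda>t. f t + f' t), (\<lambda>t. g t + g' t)) \<in> G" if G: "(f, g) \<in> G" "(f', g') \<in> G" for f g f' g'
  proof -
    have L2: "f \<in> L2" "g \<in> L2" "f' \<in> L2" "g' \<in> L2" using G by (auto simp: G_def)
    have "\<exists>F. near e (\<lambda>t. f t + f' t) (\<lambda>t. g t + g' t) F" if e: "e > 0" for e :: real
    proof -
      obtain F where F: "near (e/2) f g F" using G e unfolding G_def by (auto dest!: spec[of _ "e/2"])
      obtain F' where F': "near (e/2) f' g' F'" using G e unfolding G_def by (auto dest!: spec[of _ "e/2"])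
      have "L2_norm (\<lambda>t. (F t - f t) + (F' t - f' t)) < e/2 + e/2"
        using F F' L2 by (intro L2_norm_add_less L2_diff) (auto simp: near_def DL2)
      moreover have "L2_norm (\<lambda>t. (T F t - g t) + (T F' t - g' t)) < e/2 + e/2"
        using F F' L2 by (intro L2_norm_add_less L2_diff) (auto simp: near_def DL2)
      ultimately have "near e (\<lambda>t. f t + f' t) (\<lambda>t. g t + g' t) (\<lambda>t. F t + F' t)"
        using F F' by (simp add: near_def D T L2_add algebra_simps)
      then show ?thesis by blast
    qed
    then show ?thesis using L2 by (simp add: G_def L2_add)
  qed
  have scale: "((\<lambda>t. c * f t), (\<lambda>t. c * g t)) \<in> G" if G: "(f, g) \<in> G" for c f g
  proof -
    have L2: "f \<in> L2" "g \<in> L2" using G by (auto simp: G_def)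
    have "\<exists>F. near e (\<lambda>t. c * f t) (\<lambda>t. c * g t) F" if e: "e > 0" for e :: real
    proof -
      define d where "d = e / (cmod c + 1)"
      have c1: "0 < cmod c + 1" by (simp add: add_nonneg_pos)
      have d: "d > 0" using e c1 by (simp add: d_def)
      have cd: "cmod c * x < e" if "x < d" "0 \<le> x" for x
      proof -
        have "cmod c * x \<le> cmod c * d" using that by (simp add: mult_left_mono)
        also have "\<dots> < (cmod c + 1) * d" using d by (simp add: algebra_simps)
        also have "\<dots> = e" using c1 by (simp add: d_def)
        finally show ?thesis .
      qed
      obtain F where F: "near d f g F" using G d unfolding G_def by auto
      have "L2_norm (\<lambda>t. c * (F t - f t)) < e" "L2_norm (\<lambda>t. c * (T F t - g t)) < e"
        using F unfolding L2_norm_scale by (auto intro!: cd simp: near_def L2_norm_nonneg)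
      then have "near e (\<lambda>t. c * f t) (\<lambda>t. c * g t) (\<lambda>t. c * F t)"
        using F by (simp add: near_def D T L2_scale algebra_simps)
      then show ?thesis by blast
    qed
    then show ?thesis using L2 by (simp add: G_def L2_scale)
  qed
  have single: "AE t in lborel. g t = g' t"
    if G: "(f, g) \<in> G" "(f', g') \<in> G" and ff': "AE t in lborel. f t = f' t" for f g f' g'
  proof -
    have L2: "f \<in> L2" "g \<in> L2" "f' \<in> L2" "g' \<in> L2" using G by (auto simp: G_def)
    have window: "AE t in lborel. indicator {- real R..real R} t * (g t - g' t) = 0" for R :: nat
    proof -
      let ?I = "\<lambda>t. indicator {- real R..real R} t :: complex"
      have K_L2: "(\<lambda>t. ?I t * (g t - g' t)) \<in> L2"
        by (rule L2_truncated(1)[OF L2_diff[OF L2(2,4)]])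
      have "L2_norm (\<lambda>t. ?I t * (g t - g' t)) \<le> (3 + 2 * \<bar>C\<bar> * sqrt (2 * real R)) * e" if e: "e > 0" for e :: real
      proof -
        obtain F where F: "near e f g F" using G e unfolding G_def by auto
        obtain F' where F': "near e f' g' F'" using G e unfolding G_def by auto
        define H where "H = (\<lambda>t. F t + (-1) * F' t)"
        have "(\<lambda>t. (-1) * F' t) \<in> D"
          using F' by (intro D(4)) (simp add: near_def)
        then have HD: "H \<in> D" and TH: "T H t = T F t - T F' t" for t
          using F F' D(3)[of F "\<lambda>t. (-1) * F' t"] T(1)[of F "\<lambda>t. (-1) * F' t"] T(2)[of F' "-1"]
          by (simp_all add: near_def H_def)
        \<comment> \<open>Since \<open>f = f'\<close> almost everywhere, both \<open>F\<close> and \<open>F'\<close> approximate \<open>f\<close>.\<close>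
        have F'f: "L2_norm (\<lambda>t. F' t - f t) = L2_norm (\<lambda>t. F' t - f' t)"
          using L2 F' DL2[of F'] ff' by (intro L2_norm_cong_AE) (auto simp: L2_def near_def)
        have "L2_norm (\<lambda>t. (F t - f t) - (F' t - f t)) < e + e"
          using F F' L2 F'f by (intro L2_norm_diff_less L2_diff) (auto simp: near_def DL2)
        then have normH: "L2_norm H < 2 * e" by (simp add: H_def)
        have THb: "cmod (T H t) \<le> \<bar>C\<bar> * (2 * e)" for t
        proof -
          have "cmod (T H t) \<le> C * L2_norm H" by (rule bound[OF HD])
          also have "\<dots> \<le> \<bar>C\<bar> * L2_norm H" by (intro mult_right_mono) (auto simp: L2_norm_nonneg)
          also have "\<dots> \<le> \<bar>C\<bar> * (2 * e)" using normH by (intro mult_left_mono) auto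
          finally show ?thesis .
        qed
        have TH_L2: "(\<lambda>t. T F t - T F' t) \<in> L2"
          using F F' by (intro L2_diff) (auto simp: near_def)
        have TH_meas: "T H \<in> borel_measurable lborel"
          using TH_L2 by (simp add: TH[abs_def] L2_def)
        let ?E = "\<lambda>t. (T F t - g t) - (T F' t - g' t)"
        have E_L2: "?E \<in> L2" using F F' L2 by (intro L2_diff) (auto simp: near_def)
        have E: "L2_norm ?E < e + e"
          using F F' L2 by (intro L2_norm_diff_less L2_diff) (auto simp: near_def)
        have IE_L2: "(\<lambda>t. ?I t * ?E t) \<in> L2" and IE: "L2_norm (\<lambda>t. ?I t * ?E t) \<le> L2_norm ?E"
          by (rule L2_truncated[OF E_L2])+
        have "L2_norm (\<lambda>t. ?I t * T H t) \<le> (\<bar>C\<bar> * (2 * e)) * sqrt (2 * real R)"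
          by (rule L2_truncated_bounded(2)[OF TH_meas THb]) simp
        then have "L2_norm (\<lambda>t. ?I t * T H t) < (\<bar>C\<bar> * (2 * e)) * sqrt (2 * real R) + e"
          using e by linarith
        then have "L2_norm (\<lambda>t. ?I t * T H t - ?I t * ?E t)
            < (\<bar>C\<bar> * (2 * e)) * sqrt (2 * real R) + e + (e + e)"
          using IE E
          by (intro L2_norm_diff_less L2_truncated_bounded(1)[OF TH_meas THb] IE_L2) auto
        also have "(\<lambda>t. ?I t * T H t - ?I t * ?E t) = (\<lambda>t. ?I t * (g t - g' t))"
          by (auto simp: TH algebra_simps)
        finally show ?thesis by (simp add: algebra_simps)
      qed
      then have "L2_norm (\<lambda>t. ?I t * (g t - g' t)) = 0"
        by (intro real_eq_0_if_le_mult[OF L2_norm_nonneg])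
      then show ?thesis by (rule L2_norm_eq_0_AE[OF K_L2])
    qed
    then have "AE t in lborel. \<forall>R::nat. indicator {- real R..real R} t * (g t - g' t) = 0"
      unfolding AE_all_countable using window by blast
    then show ?thesis
    proof eventually_elim
      case *: (elim t)
      obtain R :: nat where "\<bar>t\<bar> \<le> real R" using real_arch_simple by blast
      then show "g t = g' t" using *[rule_format, of R] by (simp add: indicator_def abs_le_iff split: if_splits)
    qed
  qed
  have operator: "L2_operator G"
    unfolding L2_operator_def
    by (intro conjI allI impI G_sub zero) (rule add scale single; assumption)+
  have limit: "(f, g) \<in> G"
    if XY: "\<And>n. (X n, Y n) \<in> G" and L2: "f \<in> L2" "g \<in> L2" and lim: "L2_tendsto X f" "L2_tendsto Y g"
    for X Y f g
  proof -
    have XYL2: "X n \<in> L2" "Y n \<in> L2" for n using XY[of n] by (auto simp: G_def)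
    have "\<exists>F. near e f g F" if e: "e > 0" for e :: real
    proof -
      have "\<forall>\<^sub>F n in sequentially. L2_norm (\<lambda>t. X n t - f t) < e/2 \<and> L2_norm (\<lambda>t. Y n t - g t) < e/2"
        using lim e unfolding L2_tendsto_def by (intro eventually_conj order_tendstoD(2)) auto
      then obtain n where n: "L2_norm (\<lambda>t. X n t - f t) < e/2" "L2_norm (\<lambda>t. Y n t - g t) < e/2"
        by (auto simp: eventually_sequentially)
      obtain F where F: "near (e/2) (X n) (Y n) F"
        using XY[of n] e unfolding G_def by (auto dest!: spec[of _ "e/2"])
      have "L2_norm (\<lambda>t. (F t - X n t) + (X n t - f t)) < e/2 + e/2"
        using F L2 n XYL2 by (intro L2_norm_add_less L2_diff) (auto simp: near_def DL2)
      moreover have "L2_norm (\<lambda>t. (T F t - Y n t) + (Y n t - g t)) < e/2 + e/2"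
        using F L2 n XYL2 by (intro L2_norm_add_less L2_diff) (auto simp: near_def DL2)
      ultimately have "near e f g F" using F by (simp add: near_def)
      then show ?thesis by blast
    qed
    then show ?thesis using L2 by (simp add: G_def)
  qed
  have "L2_closed_operator G"
    unfolding L2_closed_operator_def
  proof (intro conjI allI impI operator)
    fix X Y f g
    assume "\<forall>n. (X n, Y n) \<in> G" "f \<in> L2" "g \<in> L2" "L2_tendsto X f" "L2_tendsto Y g"
    then show "(f, g) \<in> G" using limit[of X Y f g] by simp
  qed
  then show ?thesis
    unfolding L2_closable_def by (intro exI[of _ G] conjI ballI impI graph)
qed

section \<open>Fourier transforms of integrable functions\<close>

lemma borel_measurable_cnj [measurable]: "cnj \<in> borel_measurable borel"
  by (intro borel_measurable_continuous_onI continuous_intros)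

lemma cmod_fourier_kernel: "cmod (exp (- \<i> * complex_of_real s * complex_of_real x)) = 1"
  by (simp add: norm_exp_eq_Re)

lemma integrable_fourier_kernel:
  assumes "integrable lborel \<psi>"
  shows "integrable lborel (\<lambda>s. \<psi> s * exp (- \<i> * complex_of_real s * complex_of_real x))"
  by (rule Bochner_Integration.integrable_bound[OF assms])
     (use assms in \<open>auto simp: norm_mult cmod_fourier_kernel\<close>)

lemma cmod_fourier_le:
  "cmod (fourier \<psi> x) \<le> (LINT s|lborel. cmod (\<psi> s)) / sqrt (2 * pi)"
proof -
  have "cmod (LINT s|lborel. \<psi> s * exp (- \<i> * complex_of_real s * complex_of_real x))
      \<le> (LINT s|lborel. cmod (\<psi> s * exp (- \<i> * complex_of_real s * complex_of_real x)))"
    by (rule integral_norm_bound)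
  also have "\<dots> = (LINT s|lborel. cmod (\<psi> s))"
    by (simp only: norm_mult cmod_fourier_kernel mult_1_right)
  finally show ?thesis
    by (simp add: fourier_def norm_mult norm_divide divide_right_mono)
qed

lemma borel_measurable_fourier:
  assumes [measurable]: "\<psi> \<in> borel_measurable borel"
  shows "fourier \<psi> \<in> borel_measurable borel"
  unfolding fourier_def[abs_def] by measurable

text \<open>
  Both sides are the same double integral, since the kernel is symmetric in \<open>s\<close> and \<open>x\<close>.
\<close>

lemma fourier_mult_formula:
  assumes \<psi>: "integrable lborel \<psi>" and h: "integrable lborel h"
  shows "(LINT x|lborel. fourier \<psi> x * h x) = (LINT s|lborel. \<psi> s * fourier h s)"
proof -
  have [measurable]: "\<psi> \<in> borel_measurable borel" "h \<in> borel_measurable borel"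
    using assms by (auto dest: borel_measurable_integrable)
  let ?k = "\<lambda>x s. complex_of_real (1 / sqrt (2 * pi)) *
    (\<psi> s * h x * exp (- \<i> * complex_of_real s * complex_of_real x))"
  have "integrable (lborel \<Otimes>\<^sub>M lborel) (case_prod ?k)"
  proof (rule lborel_pair.Fubini_integrable)
    have "(\<lambda>x. LINT s|lborel. norm (case_prod ?k (x, s)))
        = (\<lambda>x. 1 / sqrt (2 * pi) * ((LINT s|lborel. cmod (\<psi> s)) * cmod (h x)))"
      by (simp add: norm_mult norm_divide cmod_fourier_kernel[simplified])
    then show "integrable lborel (\<lambda>x. LINT s|lborel. norm (case_prod ?k (x, s)))"
      using h by simp
    show "AE x in lborel. integrable lborel (\<lambda>s. case_prod ?k (x, s))"
      using integrable_fourier_kernel[OF \<psi>]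
      by (intro AE_I2) (simp only: case_prod_conv, intro integrable_mult_right, subst mult.commute[of "\<psi> _"],
        simp only: mult.assoc, intro integrable_mult_right)
  qed measurable
  from lborel_pair.Fubini_integral[OF this]
  have swap: "(LINT s|lborel. LINT x|lborel. ?k x s) = (LINT x|lborel. LINT s|lborel. ?k x s)" .
  have "(LINT x|lborel. ?k x s) = \<psi> s * fourier h s" for s
    unfolding fourier_def
    by (simp only: integral_mult_right_zero[symmetric], intro Bochner_Integration.integral_cong)
       (simp_all add: algebra_simps)
  moreover have "(LINT s|lborel. ?k x s) = fourier \<psi> x * h x" for x
    unfolding fourier_def
    by (simp only: integral_mult_right_zero[symmetric] integral_mult_left_zero[symmetric], intro Bochner_Integration.integral_cong)
       (simp_all add: algebra_simps)
  ultimately show ?thesis using swap by (simp only:)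
qed

lemma integrable_gauss:
  assumes "\<sigma> > 0"
  shows "integrable lborel (\<lambda>x. exp (- (\<sigma> * x)\<^sup>2 / 2) :: real)"
proof -
  have "integrable lborel (\<lambda>x. sqrt (2 * pi) * std_normal_density (0 + \<sigma> * x))"
    using assms by (intro integrable_mult_right lborel_integrable_real_affine) auto
  then show ?thesis by (simp add: std_normal_density_def)
qed

text \<open>
  The characteristic function of the standard normal distribution, rescaled.
\<close>

lemma fourier_gauss:
  assumes "\<sigma> > 0"
  shows "fourier (\<lambda>x. complex_of_real (exp (- (\<sigma> * x)\<^sup>2 / 2))) y
    = complex_of_real (exp (- (y / \<sigma>)\<^sup>2 / 2) / \<sigma>)"
proof -
  let ?e = "\<lambda>w. iexp (- (y / \<sigma>) * w)"
  have "complex_of_real (exp (- (- (y / \<sigma>))\<^sup>2 / 2)) = (LINT w|std_normal_distribution. ?e w)"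
    using fun_cong[OF char_std_normal_distribution, of "- (y / \<sigma>)"]
    by (simp add: char_def)
  also have "\<dots> = (LINT w|lborel. std_normal_density w *\<^sub>R ?e w)"
    by (subst integral_density) auto
  also have "\<dots> = \<sigma> *\<^sub>R (LINT x|lborel. std_normal_density (0 + \<sigma> * x) *\<^sub>R ?e (0 + \<sigma> * x))"
    using assms by (subst lborel_integral_real_affine[where c=\<sigma> and t=0]) auto
  also have "(LINT x|lborel. std_normal_density (0 + \<sigma> * x) *\<^sub>R ?e (0 + \<sigma> * x))
      = fourier (\<lambda>x. complex_of_real (exp (- (\<sigma> * x)\<^sup>2 / 2))) y"
    unfolding fourier_def integral_mult_right_zero[symmetric]
    using assms by (intro Bochner_Integration.integral_cong)
      (simp_all add: std_normal_density_def scaleR_conv_of_real mult_ac)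
  finally show ?thesis using assms by (simp add: scaleR_conv_of_real field_simps)
qed

lemma fourier_modulate:
  "fourier (\<lambda>x. exp (- \<i> * complex_of_real s * complex_of_real x) * h x) t = fourier h (s + t)"
proof -
  have "exp (- \<i> * complex_of_real (s + t) * complex_of_real x)
      = exp (- \<i> * complex_of_real s * complex_of_real x) * exp (- \<i> * complex_of_real x * complex_of_real t)"
    for x
    by (simp add: exp_add[symmetric] algebra_simps)
  then have "h x * exp (- \<i> * complex_of_real x * complex_of_real (s + t))
      = exp (- \<i> * complex_of_real s * complex_of_real x) * h x * exp (- \<i> * complex_of_real x * complex_of_real t)"
    for x
    by (simp only: mult_ac)
  then show ?thesis by (simp only: fourier_def mult_ac)
qed

lemma cnj_fourier: "cnj (fourier \<psi> x) = fourier (\<lambda>s. cnj (\<psi> (- s))) x"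
proof -
  have "(LINT s|lborel. cnj (\<psi> (- s)) * exp (- \<i> * complex_of_real s * complex_of_real x))
     = (LINT s|lborel. cnj (\<psi> s) * exp (\<i> * complex_of_real s * complex_of_real x))"
    by (subst lborel_integral_real_affine[where c="-1" and t=0]) simp_all
  then show ?thesis
    by (simp add: fourier_def exp_cnj flip: Bochner_Integration.integral_cnj)
qed

text \<open>
  The multiplication formula is used twice, each time to move a Fourier transform off \<open>\<psi>\<close>: first
  off \<open>F = fourier \<psi>\<close>, with \<open>h = cnj F * g\<close> for the Gaussian weight \<open>g\<close>, and then off the factor
  \<open>cnj F\<close> in the transform of \<open>h\<close>. What remains is the transform of \<open>g\<close>, up to normalisation a normal
  density of standard deviation \<open>\<sigma>\<close>; a substitution makes \<open>\<sigma>\<close> appear only in the argument of \<open>\<psi>\<close>,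
  where it is harmless as \<open>\<sigma> \<rightarrow> 0\<close>.
\<close>

lemma fourier_gauss_regularised:
  assumes \<psi>: "integrable lborel \<psi>" and \<sigma>: "\<sigma> > 0"
  shows "(LINT x|lborel. (cmod (fourier \<psi> x))\<^sup>2 * exp (- (\<sigma> * x)\<^sup>2 / 2))
    = (LINT s|lborel. \<psi> s * (LINT z|lborel. cnj (\<psi> (s + \<sigma> * z)) * std_normal_density z))"
    (is "complex_of_real ?W = _")
    and "integrable lborel (\<lambda>x. (cmod (fourier \<psi> x))\<^sup>2 * exp (- (\<sigma> * x)\<^sup>2 / 2))"
proof -
  define g where "g x = complex_of_real (exp (- (\<sigma> * x)\<^sup>2 / 2))" for x
  define h where "h x = cnj (fourier \<psi> x) * g x" for x
  have [measurable]: "\<psi> \<in> borel_measurable borel"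
    using \<psi> by (auto dest: borel_measurable_integrable)
  have [measurable]: "fourier \<psi> \<in> borel_measurable borel"
    by (rule borel_measurable_fourier) measurable
  have g: "integrable lborel g"
    unfolding g_def using integrable_gauss[OF \<sigma>] by simp
  then have [measurable]: "g \<in> borel_measurable borel" by auto
  have [measurable]: "h \<in> borel_measurable borel" unfolding h_def[abs_def] by measurable
  have \<psi>m: "integrable lborel (\<lambda>s. cnj (\<psi> (- s)))"
    using lborel_integrable_real_affine[OF \<psi>, of "-1" 0] by simp
  define M where "M = (LINT s|lborel. cmod (\<psi> s)) / sqrt (2 * pi)"
  have M: "cmod (fourier \<psi> x) \<le> M" for x unfolding M_def by (rule cmod_fourier_le)
  have M0: "0 \<le> M" using M[of 0] norm_ge_zero order_trans by blast
  have h: "integrable lborel h"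
    by (rule Bochner_Integration.integrable_bound[OF integrable_mult_right[OF g, of "complex_of_real M"]])
       (auto simp: h_def norm_mult M M0 intro!: AE_I2 mult_right_mono)
  have fh: "fourier \<psi> x * h x = complex_of_real ((cmod (fourier \<psi> x))\<^sup>2 * exp (- (\<sigma> * x)\<^sup>2 / 2))" for x
    by (simp add: h_def g_def complex_norm_square mult_ac del: of_real_power)
  have "integrable lborel (\<lambda>x. fourier \<psi> x * h x)"
    by (rule Bochner_Integration.integrable_bound[OF integrable_mult_right[OF h, of "complex_of_real M"]])
       (auto simp: norm_mult M M0 h_def intro!: AE_I2 mult_right_mono)
  then show "integrable lborel (\<lambda>x. (cmod (fourier \<psi> x))\<^sup>2 * exp (- (\<sigma> * x)\<^sup>2 / 2))"
    unfolding fh by (subst (asm) complex_of_real_integrable_eq)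
  have "complex_of_real ?W = (LINT x|lborel. fourier \<psi> x * h x)"
    unfolding fh by (rule integral_complex_of_real[symmetric])
  also have "\<dots> = (LINT s|lborel. \<psi> s * fourier h s)"
    by (rule fourier_mult_formula[OF \<psi> h])
  also have "fourier h = (\<lambda>s. LINT z|lborel. cnj (\<psi> (s + \<sigma> * z)) * std_normal_density z)"
  proof
    fix s
    define gs where "gs x = exp (- \<i> * complex_of_real s * complex_of_real x) * g x" for x
    have gs: "integrable lborel gs"
      unfolding gs_def using integrable_fourier_kernel[OF g, of s] by (simp add: mult_ac)
    have "fourier h s = complex_of_real (1 / sqrt (2 * pi)) *
        (LINT x|lborel. fourier (\<lambda>s. cnj (\<psi> (- s))) x * gs x)"
      unfolding fourier_def[of h] h_def gs_def cnj_fourier by (simp add: mult_ac)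
    also have "\<dots> = complex_of_real (1 / sqrt (2 * pi)) *
        (LINT t|lborel. cnj (\<psi> (- t)) * fourier g (s + t))"
      by (subst fourier_mult_formula[OF \<psi>m gs]) (simp only: gs_def[abs_def] fourier_modulate)
    \<comment> \<open>The substitution is \<open>t = - (s + \<sigma> z)\<close>; its Jacobian cancels the factor \<open>1 / \<sigma>\<close> of \<open>fourier g\<close>.\<close>
    also have "(LINT t|lborel. cnj (\<psi> (- t)) * fourier g (s + t))
        = (LINT z|lborel. cnj (\<psi> (s + \<sigma> * z)) * complex_of_real (exp (- z\<^sup>2 / 2)))"
      unfolding g_def fourier_gauss[OF \<sigma>]
      using \<sigma> by (subst lborel_integral_real_affine[where c="-\<sigma>" and t="-s"])
        (simp_all add: scaleR_conv_of_real power2_eq_square add.commute)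
    finally show "fourier h s = (LINT z|lborel. cnj (\<psi> (s + \<sigma> * z)) * std_normal_density z)"
      by (simp add: std_normal_density_def mult_ac flip: integral_mult_right_zero)
  qed
  finally show "complex_of_real ?W
    = (LINT s|lborel. \<psi> s * (LINT z|lborel. cnj (\<psi> (s + \<sigma> * z)) * std_normal_density z))" .
qed

section \<open>The Plancherel identity\<close>

lemma integrable_continuous_compact_support:
  fixes f :: "real \<Rightarrow> 'a :: {banach, second_countable_topology}"
  assumes cont: "continuous_on UNIV f" and supp: "\<And>s. s \<notin> {a..b} \<Longrightarrow> f s = 0"
  shows "integrable lborel f"
proof -
  have "integrable lborel (\<lambda>s. indicator {a..b} s *\<^sub>R f s)"
    by (rule borel_integrable_compact) (auto intro: continuous_on_subset[OF cont])
  also have "(\<lambda>s. indicator {a..b} s *\<^sub>R f s) = f"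
    using supp by (auto split: split_indicator)
  finally show ?thesis .
qed

text \<open>
  Both assertions come out of a single limit: the regularised integrals increase as \<open>\<sigma>\<close> decreases,
  and their limit is finite because the Gaussian averages \<open>N n s\<close> of \<open>cnj \<psi>\<close> around \<open>s\<close> stay bounded
  and tend to \<open>cnj (\<psi> s)\<close> by continuity.
\<close>

theorem plancherel_continuous_compact_support:
  assumes cont: "continuous_on UNIV \<psi>" and supp: "\<And>s. s \<notin> {a..b} \<Longrightarrow> \<psi> s = 0"
  shows "integrable lborel (\<lambda>x. (cmod (fourier \<psi> x))\<^sup>2)"
    and "(LINT x|lborel. (cmod (fourier \<psi> x))\<^sup>2) = (LINT s|lborel. (cmod (\<psi> s))\<^sup>2)"
proof -
  have [measurable]: "\<psi> \<in> borel_measurable borel"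
    by (rule borel_measurable_continuous_onI[OF cont])
  have int: "integrable lborel \<psi>"
    by (rule integrable_continuous_compact_support[OF cont supp])
  have "compact (\<psi> ` {a..b})"
    by (intro compact_continuous_image compact_Icc continuous_on_subset[OF cont]) auto
  then obtain M where M: "\<And>s. s \<in> {a..b} \<Longrightarrow> cmod (\<psi> s) \<le> M" and "M > 0"
    using bounded_pos[of "\<psi> ` {a..b}"] compact_imp_bounded by (metis imageI)
  then have M: "cmod (\<psi> s) \<le> M" for s
    using supp[of s] by (cases "s \<in> {a..b}") auto
  define \<sigma> where "\<sigma> n = 1 / real (Suc n)" for n
  have \<sigma>: "\<sigma> n > 0" for n by (simp add: \<sigma>_def)
  have \<sigma>0: "\<sigma> \<longlonglongrightarrow> 0" unfolding \<sigma>_def[abs_def] by (rule LIMSEQ_Suc[OF lim_1_over_n])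
  define N where "N n s = (LINT z|lborel. cnj (\<psi> (s + \<sigma> n * z)) * std_normal_density z)" for n s
  have dom: "cmod (cnj (\<psi> (s + \<sigma> n * z)) * std_normal_density z) \<le> M * std_normal_density z" for s n z
    using M[of "s + \<sigma> n * z"] by (simp add: norm_mult mult_right_mono)
  have intMN: "integrable lborel (\<lambda>z. M * std_normal_density z)" by simp
  have N_lim: "(\<lambda>n. N n s) \<longlonglongrightarrow> cnj (\<psi> s)" for s
  proof -
    have "(\<lambda>n. N n s) \<longlonglongrightarrow> (LINT z|lborel. cnj (\<psi> s) * std_normal_density z)"
      unfolding N_def
    proof (rule integral_dominated_convergence[OF _ _ intMN])
      show "AE z in lborel. (\<lambda>n. cnj (\<psi> (s + \<sigma> n * z)) * std_normal_density z)
          \<longlonglongrightarrow> cnj (\<psi> s) * std_normal_density z"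
      proof (intro AE_I2 tendsto_mult tendsto_cnj tendsto_const)
        fix z
        have "(\<lambda>n. s + \<sigma> n * z) \<longlonglongrightarrow> s + 0 * z"
          by (intro tendsto_intros \<sigma>0)
        then show "(\<lambda>n. \<psi> (s + \<sigma> n * z)) \<longlonglongrightarrow> \<psi> s"
          using cont by (intro isCont_tendsto_compose[of s \<psi>]) (auto simp: continuous_on_eq_continuous_at)
      qed
    qed (measurable, use dom in auto)
    then show ?thesis by simp
  qed
  have N_bound: "cmod (N n s) \<le> M" for n s
  proof -
    have "cmod (N n s) \<le> (LINT z|lborel. M * std_normal_density z)"
      unfolding N_def by (rule Bochner_Integration.integral_norm_bound_integral)
        (intro Bochner_Integration.integrable_bound[OF intMN], measurable,
         use dom \<open>M > 0\<close> in auto)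
    then show ?thesis by simp
  qed
  have [measurable]: "N n \<in> borel_measurable borel" for n
    unfolding N_def[abs_def] by measurable
  have "(\<lambda>n. LINT s|lborel. \<psi> s * N n s) \<longlonglongrightarrow> (LINT s|lborel. \<psi> s * cnj (\<psi> s))"
  proof (rule integral_dominated_convergence)
    show "integrable lborel (\<lambda>s. M * cmod (\<psi> s))" using int by simp
    show "AE s in lborel. (\<lambda>n. \<psi> s * N n s) \<longlonglongrightarrow> \<psi> s * cnj (\<psi> s)"
      by (intro AE_I2 tendsto_intros N_lim)
    show "AE s in lborel. cmod (\<psi> s * N n s) \<le> M * cmod (\<psi> s)" for n
      using mult_right_mono[OF N_bound norm_ge_zero] by (intro AE_I2) (simp add: norm_mult mult.commute)
  qed measurable
  also have "(\<lambda>n. LINT s|lborel. \<psi> s * N n s) =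
      (\<lambda>n. complex_of_real (LINT x|lborel. (cmod (fourier \<psi> x))\<^sup>2 * exp (- (\<sigma> n * x)\<^sup>2 / 2)))"
    unfolding fourier_gauss_regularised(1)[OF int \<sigma>] N_def ..
  also have "(LINT s|lborel. \<psi> s * cnj (\<psi> s)) = complex_of_real (LINT s|lborel. (cmod (\<psi> s))\<^sup>2)"
    unfolding complex_norm_square[symmetric] by (rule integral_complex_of_real)
  finally have lim: "(\<lambda>n. LINT x|lborel. (cmod (fourier \<psi> x))\<^sup>2 * exp (- (\<sigma> n * x)\<^sup>2 / 2))
      \<longlonglongrightarrow> (LINT s|lborel. (cmod (\<psi> s))\<^sup>2)"
    by (simp only: tendsto_of_real_iff)
  have mono: "mono (\<lambda>n. (cmod (fourier \<psi> x))\<^sup>2 * exp (- (\<sigma> n * x)\<^sup>2 / 2))" for x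
  proof (intro monoI mult_left_mono)
    fix m n :: nat assume "m \<le> n"
    then have "\<bar>\<sigma> n * x\<bar> \<le> \<bar>\<sigma> m * x\<bar>"
      by (auto simp: abs_mult \<sigma>_def intro!: mult_right_mono divide_left_mono)
    then have "(\<sigma> n * x)\<^sup>2 \<le> (\<sigma> m * x)\<^sup>2" by (simp only: abs_le_square_iff)
    then show "exp (- (\<sigma> m * x)\<^sup>2 / 2) \<le> exp (- (\<sigma> n * x)\<^sup>2 / 2)" by simp
  qed simp
  have ptw: "(\<lambda>n. (cmod (fourier \<psi> x))\<^sup>2 * exp (- (\<sigma> n * x)\<^sup>2 / 2)) \<longlonglongrightarrow> (cmod (fourier \<psi> x))\<^sup>2" for x
  proof -
    have "(\<lambda>n. (cmod (fourier \<psi> x))\<^sup>2 * exp (- (\<sigma> n * x)\<^sup>2 / 2))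
        \<longlonglongrightarrow> (cmod (fourier \<psi> x))\<^sup>2 * exp (- (0 * x)\<^sup>2 / 2)"
      by (intro tendsto_intros \<sigma>0) simp
    then show ?thesis by simp
  qed
  have meas: "(\<lambda>x. (cmod (fourier \<psi> x))\<^sup>2) \<in> borel_measurable lborel"
    using borel_measurable_fourier[of \<psi>] by measurable
  note mc = integral_monotone_convergence_nonneg[OF fourier_gauss_regularised(2)[OF int \<sigma>] _ _ _ lim meas]
  show "integrable lborel (\<lambda>x. (cmod (fourier \<psi> x))\<^sup>2)"
    by (rule mc(1)) (intro AE_I2 mono ptw, simp, intro AE_I2 ptw)
  show "(LINT x|lborel. (cmod (fourier \<psi> x))\<^sup>2) = (LINT s|lborel. (cmod (\<psi> s))\<^sup>2)"
    by (rule mc(2)) (intro AE_I2 mono ptw, simp, intro AE_I2 ptw)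
qed

section \<open>Band-limited functions are bounded by their norm\<close>

text \<open>
  The Cauchy-Schwarz inequality against the indicator of the interval, read off from the
  nonnegative variance: \<open>m\<close> is the mean of \<open>f\<close> over \<open>[a, b]\<close>.
\<close>

lemma integral_square_le_compact_support:
  fixes f :: "real \<Rightarrow> real"
  assumes f: "integrable lborel f" and f2: "integrable lborel (\<lambda>s. (f s)\<^sup>2)"
    and supp: "\<And>s. s \<notin> {a..b} \<Longrightarrow> f s = 0" and "a < b"
  shows "(LINT s|lborel. f s)\<^sup>2 \<le> (b - a) * (LINT s|lborel. (f s)\<^sup>2)"
proof -
  define I where "I = (LINT s|lborel. f s)"
  define m where "m = I / (b - a)"
  have ind: "integrable lborel (\<lambda>s. m\<^sup>2 * indicator {a..b} s)"
    using \<open>a < b\<close> by (intro integrable_mult_right integrable_real_indicator) auto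
  have "0 \<le> (LINT s|lborel. (f s - m * indicator {a..b} s)\<^sup>2)"
    by (intro integral_nonneg_AE) simp
  also have "(\<lambda>s. (f s - m * indicator {a..b} s)\<^sup>2)
      = (\<lambda>s. (f s)\<^sup>2 - 2 * m * f s + m\<^sup>2 * indicator {a..b} s)"
    using supp by (auto split: split_indicator simp: power2_eq_square algebra_simps)
  also have "(LINT s|lborel. (f s)\<^sup>2 - 2 * m * f s + m\<^sup>2 * indicator {a..b} s)
      = (LINT s|lborel. (f s)\<^sup>2) - 2 * m * I + m\<^sup>2 * (b - a)"
    using f f2 ind \<open>a < b\<close> by (simp add: I_def)
  also have "\<dots> = (LINT s|lborel. (f s)\<^sup>2) - I\<^sup>2 / (b - a)"
    using \<open>a < b\<close> by (simp add: m_def power2_eq_square)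
  finally show ?thesis
    using \<open>a < b\<close> by (simp add: I_def pos_divide_le_eq mult.commute)
qed

text \<open>
  Cauchy-Schwarz bounds the transform by the \<open>L\<^sup>2\<close> norm of \<open>\<psi>\<close>, which Plancherel carries over to the
  transform itself. On \<open>[-\<pi>, \<pi>]\<close> the constant is \<open>1\<close>.
\<close>

lemma fourier_sup_le_L2_norm:
  assumes cont: "continuous_on UNIV \<psi>" and supp: "\<And>s. s \<notin> {a..b} \<Longrightarrow> \<psi> s = 0" and "a < b"
  shows "cmod (fourier \<psi> x) \<le> sqrt ((b - a) / (2 * pi)) * L2_norm (fourier \<psi>)"
proof -
  have "(LINT s|lborel. cmod (\<psi> s))\<^sup>2 \<le> (b - a) * (LINT s|lborel. (cmod (\<psi> s))\<^sup>2)"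
    using supp \<open>a < b\<close>
    by (intro integral_square_le_compact_support
        integrable_continuous_compact_support[where a=a and b=b] continuous_intros cont) auto
  then have "(LINT s|lborel. cmod (\<psi> s)) \<le> sqrt ((b - a) * (LINT s|lborel. (cmod (\<psi> s))\<^sup>2))"
    by (rule real_le_rsqrt)
  also have "(LINT s|lborel. (cmod (\<psi> s))\<^sup>2) = (L2_norm (fourier \<psi>))\<^sup>2"
    unfolding L2_norm_power2
    by (rule plancherel_continuous_compact_support(2)[OF cont supp, symmetric])
  also have "sqrt ((b - a) * (L2_norm (fourier \<psi>))\<^sup>2) = sqrt (b - a) * L2_norm (fourier \<psi>)"
    by (simp add: real_sqrt_mult L2_norm_nonneg)
  finally have "(LINT s|lborel. cmod (\<psi> s)) / sqrt (2 * pi)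
      \<le> sqrt (b - a) * L2_norm (fourier \<psi>) / sqrt (2 * pi)"
    by (intro divide_right_mono) auto
  then show ?thesis
    using cmod_fourier_le[of \<psi> x] by (simp add: real_sqrt_divide)
qed

section \<open>The domain of the Hausdorff operator\<close>

lemma fourier_add:
  assumes "integrable lborel \<psi>" "integrable lborel \<phi>"
  shows "fourier (\<lambda>s. \<psi> s + \<phi> s) x = fourier \<psi> x + fourier \<phi> x"
proof -
  have "(LINT s|lborel. (\<psi> s + \<phi> s) * exp (- \<i> * complex_of_real s * complex_of_real x))
      = (LINT s|lborel. \<psi> s * exp (- \<i> * complex_of_real s * complex_of_real x))
      + (LINT s|lborel. \<phi> s * exp (- \<i> * complex_of_real s * complex_of_real x))"
    unfolding distrib_right
    by (intro Bochner_Integration.integral_add integrable_fourier_kernel assms)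
  then show ?thesis by (simp only: fourier_def distrib_left)
qed

lemma fourier_scale: "fourier (\<lambda>s. c * \<psi> s) x = c * fourier \<psi> x"
  by (simp add: fourier_def mult.assoc)

lemma C2_imp_continuous: "C2 \<psi> \<Longrightarrow> continuous_on UNIV \<psi>"
  by (auto simp: C2_def continuous_on_eq_continuous_at dest!: has_vector_derivative_continuous)

lemma C2_zero: "C2 (\<lambda>s. 0)"
  unfolding C2_def by (intro exI[of _ "\<lambda>s. 0"]) auto

lemma C2_add:
  assumes "C2 \<psi>" "C2 \<phi>"
  shows "C2 (\<lambda>s. \<psi> s + \<phi> s)"
proof -
  obtain p p' q q' where
    "\<forall>x. (\<psi> has_vector_derivative p x) (at x)" "\<forall>x. (p has_vector_derivative p' x) (at x)"
    "\<forall>x. (\<phi> has_vector_derivative q x) (at x)" "\<forall>x. (q has_vector_derivative q' x) (at x)"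
    "continuous_on UNIV p'" "continuous_on UNIV q'"
    using assms unfolding C2_def by blast
  then show ?thesis
    unfolding C2_def
    by (intro exI[of _ "\<lambda>x. p x + q x"] exI[of _ "\<lambda>x. p' x + q' x"])
       (auto intro!: has_vector_derivative_add continuous_on_add)
qed

lemma C2_scale:
  assumes "C2 \<psi>"
  shows "C2 (\<lambda>s. c * \<psi> s)"
proof -
  obtain p p' where
    "\<forall>x. (\<psi> has_vector_derivative p x) (at x)" "\<forall>x. (p has_vector_derivative p' x) (at x)"
    "continuous_on UNIV p'"
    using assms unfolding C2_def by blast
  then show ?thesis
    unfolding C2_def
    by (intro exI[of _ "\<lambda>x. c * p x"] exI[of _ "\<lambda>x. c * p' x"])
       (auto intro!: has_vector_derivative_mult_right continuous_on_mult_left)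
qed

lemma mem_hausdorff_dom_iff:
  "F \<in> hausdorff_dom \<longleftrightarrow>
    (\<exists>\<psi>. C2 \<psi> \<and> (\<forall>s. s \<notin> {-pi..pi} \<longrightarrow> \<psi> s = 0) \<and> F = fourier \<psi>)"
proof -
  have "closure {s. \<psi> s \<noteq> 0} \<subseteq> {-pi..pi} \<longleftrightarrow> (\<forall>s. s \<notin> {-pi..pi} \<longrightarrow> \<psi> s = 0)"
    for \<psi> :: "real \<Rightarrow> complex"
  proof -
    have "closure {s. \<psi> s \<noteq> 0} \<subseteq> {-pi..pi} \<longleftrightarrow> {s. \<psi> s \<noteq> 0} \<subseteq> {-pi..pi}"
      using closure_subset[of "{s. \<psi> s \<noteq> 0}"] closure_minimal[OF _ closed_atLeastAtMost]
      by (meson order_trans)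
    then show ?thesis by blast
  qed
  then show ?thesis by (auto simp: hausdorff_dom_def)
qed

lemma hausdorff_dom_zero: "(\<lambda>t. 0) \<in> hausdorff_dom"
proof -
  have "fourier (\<lambda>s. 0) = (\<lambda>t. 0)" by (simp add: fourier_def[abs_def])
  then show ?thesis
    unfolding mem_hausdorff_dom_iff by (intro exI[of _ "\<lambda>s. 0"]) (simp add: C2_zero)
qed

lemma hausdorff_dom_add:
  assumes "F \<in> hausdorff_dom" "H \<in> hausdorff_dom"
  shows "(\<lambda>t. F t + H t) \<in> hausdorff_dom"
proof -
  obtain \<psi> \<phi> where \<psi>: "C2 \<psi>" "\<And>s. s \<notin> {-pi..pi} \<Longrightarrow> \<psi> s = 0" "F = fourier \<psi>"
    and \<phi>: "C2 \<phi>" "\<And>s. s \<notin> {-pi..pi} \<Longrightarrow> \<phi> s = 0" "H = fourier \<phi>"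
    using assms unfolding mem_hausdorff_dom_iff by blast
  have "integrable lborel \<psi>" "integrable lborel \<phi>"
    using \<psi> \<phi> integrable_continuous_compact_support[of _ "-pi" pi] C2_imp_continuous by blast+
  then have "(\<lambda>t. F t + H t) = fourier (\<lambda>s. \<psi> s + \<phi> s)"
    by (auto simp: fourier_add \<psi>(3) \<phi>(3))
  then show ?thesis
    unfolding mem_hausdorff_dom_iff using \<psi>(2) \<phi>(2)
    by (intro exI[of _ "\<lambda>s. \<psi> s + \<phi> s"]) (simp add: C2_add \<psi>(1) \<phi>(1))
qed

lemma hausdorff_dom_scale:
  assumes "F \<in> hausdorff_dom"
  shows "(\<lambda>t. c * F t) \<in> hausdorff_dom"
proof -
  obtain \<psi> where \<psi>: "C2 \<psi>" "\<And>s. s \<notin> {-pi..pi} \<Longrightarrow> \<psi> s = 0" "F = fourier \<psi>"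
    using assms unfolding mem_hausdorff_dom_iff by blast
  then have "(\<lambda>t. c * F t) = fourier (\<lambda>s. c * \<psi> s)"
    by (auto simp: fourier_scale)
  then show ?thesis
    unfolding mem_hausdorff_dom_iff using \<psi>(2)
    by (intro exI[of _ "\<lambda>s. c * \<psi> s"]) (simp add: C2_scale \<psi>(1))
qed

lemma hausdorff_dom_L2_sup_bound:
  assumes "F \<in> hausdorff_dom"
  shows "F \<in> L2" and "cmod (F x) \<le> L2_norm F"
proof -
  obtain \<psi> where \<psi>: "C2 \<psi>" and supp: "\<And>s. s \<notin> {-pi..pi} \<Longrightarrow> \<psi> s = 0" and F: "F = fourier \<psi>"
    using assms unfolding mem_hausdorff_dom_iff by blast
  have cont: "continuous_on UNIV \<psi>" by (rule C2_imp_continuous[OF \<psi>])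
  have "\<psi> \<in> borel_measurable borel"
    by (rule borel_measurable_continuous_onI[OF cont])
  then show "F \<in> L2"
    using plancherel_continuous_compact_support(1)[OF cont, of "-pi" pi] supp
    by (simp add: F L2_def borel_measurable_fourier)
  show "cmod (F x) \<le> L2_norm F"
    using fourier_sup_le_L2_norm[OF cont, of "-pi" pi x] supp by (simp add: F)
qed

section \<open>Closability of the Hausdorff operator\<close>

text \<open>
  On the domain, \<open>\<bar>F\<bar>\<close> is at most its own \<open>L\<^sup>2\<close> norm everywhere, so \<open>\<bar>\<Phi>\<bar>\<close> times this norm dominates
  the integrand for every \<open>t\<close>. This gives at once the convergence of the integral, and with it
  linearity, and the bound by \<open>\<parallel>\<Phi>\<parallel>\<^sub>1 \<parallel>F\<parallel>\<^sub>2\<close> that makes the operator closable.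
\<close>

theorem corollary13:
  fixes \<mu> :: "real measure" and \<Phi> :: "real \<Rightarrow> complex"
  assumes "regular_borel_measure_pos \<mu>"
    and "\<Phi> \<in> borel_measurable (completion \<mu>)"
    and "integrable (completion \<mu>) \<Phi>"
  shows "L2_closable (hausdorff_op \<Phi> \<mu>) hausdorff_dom"
proof (rule L2_closable_if_sup_bounded)
  have sets: "sets \<mu> = sets (restrict_space borel {0<..})"
    using assms(1) by (simp add: regular_borel_measure_pos_def)
  have meas: "(\<lambda>u. F (t / u)) \<in> borel_measurable (completion \<mu>)" if "F \<in> hausdorff_dom" for F t
  proof -
    have [measurable]: "F \<in> borel_measurable borel"
      using hausdorff_dom_L2_sup_bound(1)[OF that] by (simp add: L2_def)
    have "(\<lambda>u. F (t / u)) \<in> borel_measurable (restrict_space borel {0<..})"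
      by (rule measurable_restrict_space1) measurable
    then have "(\<lambda>u. F (t / u)) \<in> borel_measurable \<mu>"
      by (simp cong: measurable_cong_sets add: sets)
    then show ?thesis by (rule measurable_completion)
  qed
  have dom: "cmod (\<Phi> u * F (t / u)) \<le> cmod (\<Phi> u) * L2_norm F" if "F \<in> hausdorff_dom" for F t u
    using hausdorff_dom_L2_sup_bound(2)[OF that] by (simp add: norm_mult mult_left_mono)
  have \<Phi>_dom: "integrable (completion \<mu>) (\<lambda>u. cmod (\<Phi> u) * L2_norm F)" for F
    using assms(3) by simp
  have int: "integrable (completion \<mu>) (\<lambda>u. \<Phi> u * F (t / u))" if "F \<in> hausdorff_dom" for F t
    by (rule Bochner_Integration.integrable_bound[OF \<Phi>_dom[of F]])
       (use dom[OF that] in \<open>auto intro!: borel_measurable_times assms(2) meas that AE_I2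
          order_trans[OF _ abs_ge_self]\<close>)
  show "hausdorff_op \<Phi> \<mu> (\<lambda>t. F t + H t) = (\<lambda>t. hausdorff_op \<Phi> \<mu> F t + hausdorff_op \<Phi> \<mu> H t)"
    if "F \<in> hausdorff_dom" "H \<in> hausdorff_dom" for F H
    using int that by (intro ext) (simp add: hausdorff_op_def distrib_left)
  show "hausdorff_op \<Phi> \<mu> (\<lambda>t. c * F t) = (\<lambda>t. c * hausdorff_op \<Phi> \<mu> F t)" for c F
    by (intro ext) (simp add: hausdorff_op_def mult.left_commute)
  show "cmod (hausdorff_op \<Phi> \<mu> F t) \<le> (LINT u|completion \<mu>. cmod (\<Phi> u)) * L2_norm F"
    if "F \<in> hausdorff_dom" for F t
  proof -
    have "cmod (hausdorff_op \<Phi> \<mu> F t) \<le> (LINT u|completion \<mu>. cmod (\<Phi> u) * L2_norm F)"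
      unfolding hausdorff_op_def
      by (intro Bochner_Integration.integral_norm_bound_integral int \<Phi>_dom dom that)
    then show ?thesis by simp
  qed
qed (use hausdorff_dom_L2_sup_bound(1) in
    \<open>auto intro: hausdorff_dom_zero hausdorff_dom_add hausdorff_dom_scale\<close>)

end
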